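(* Let $G$ be a Hausdorff topological gyrogroup which has an $\omega^{\omega}$-base, and let $K$ be an arbitrary compact subset of $G$. Then $K$ (with the subspace topology) is metrizable.
   Context: A gyrogroup is a nonempty set $G$ with a binary operation $\oplus$ such that: (G1) there is a unique identity element $0\in G$ with $0\oplus a=a=a\oplus 0$ for all $a\in G$; (G2) for each $x\in G$ there is a unique inverse $\ominus x\in G$ with $\ominus x\oplus x=0=x\oplus(\ominus x)$; (G3) for all $x,y\in G$ there is an automorphism $\mathrm{gyr}[x,y]$ of $(G,\oplus)$ (a bijection preserving $\oplus$) with $x\oplus(y\oplus z)=(x\oplus y)\oplus \mathrm{gyr}[x,y](z)$ for all $z\in G$; (G4) $\mathrm{gyr}[x\oplus y,y]=\mathrm{gyr}[x,y]$ for all $x,y\in G$. A topological gyrogroup is a gyrogroup with a topology such that $\oplus:G\times G\to G$ is jointly continuous and $x\mapsto\ominus x$ is continuous. $\mathbb{N}^{\mathbb{N}}$ is the set of all functions $\mathbb{N}\to\mathbb{N}$ with the partial order $f\le g$ iff $f(n)\le g(n)$ for all $n$. A space $X$ has an $\omega^{\omega}$-base if every point $x\in X$ has a base of neighborhoods of the form $\{U_\alpha(x):\alpha\in\mathbb{N}^{\mathbb{N}}\}$ with $U_\beta(x)\subset U_\alpha(x)$ whenever $\alpha\le\beta$. All topological spaces are assumed to be Hausdorff. *)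

theory Defs
  imports "HOL-Analysis.Analysis"
begin

text \<open>
  The operations are total functions on the ambient type; they are only constrained on the
  carrier \<open>G\<close>, and equality of gyroautomorphisms means equality on \<open>G\<close>.
\<close>

locale gyrogroup =
  fixes G :: "'a set"
    and add :: "'a \<Rightarrow> 'a \<Rightarrow> 'a"  (infixl "\<oplus>" 65)
    and zero :: 'a  ("\<zero>")
    and neg :: "'a \<Rightarrow> 'a"  ("\<ominus> _" [81] 80)
    and gyr :: "'a \<Rightarrow> 'a \<Rightarrow> 'a \<Rightarrow> 'a"
  assumes add_closed: "\<lbrakk>x \<in> G; y \<in> G\<rbrakk> \<Longrightarrow> x \<oplus> y \<in> G"
    and zero_closed: "\<zero> \<in> G"
    and zero_add: "a \<in> G \<Longrightarrow> \<zero> \<oplus> a = a"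
    and add_zero: "a \<in> G \<Longrightarrow> a \<oplus> \<zero> = a"
    and zero_unique: "\<lbrakk>e \<in> G; \<And>a. a \<in> G \<Longrightarrow> e \<oplus> a = a \<and> a \<oplus> e = a\<rbrakk> \<Longrightarrow> e = \<zero>"
    and neg_closed: "x \<in> G \<Longrightarrow> \<ominus> x \<in> G"
    and neg_add: "x \<in> G \<Longrightarrow> \<ominus> x \<oplus> x = \<zero>"
    and add_neg: "x \<in> G \<Longrightarrow> x \<oplus> (\<ominus> x) = \<zero>"
    and neg_unique: "\<lbrakk>x \<in> G; y \<in> G; y \<oplus> x = \<zero>; x \<oplus> y = \<zero>\<rbrakk> \<Longrightarrow> y = \<ominus> x"
    and gyr_bij: "\<lbrakk>x \<in> G; y \<in> G\<rbrakk> \<Longrightarrow> bij_betw (gyr x y) G G"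
    and gyr_add: "\<lbrakk>x \<in> G; y \<in> G; a \<in> G; b \<in> G\<rbrakk> \<Longrightarrow> gyr x y (a \<oplus> b) = gyr x y a \<oplus> gyr x y b"
    and gyr_assoc: "\<lbrakk>x \<in> G; y \<in> G; z \<in> G\<rbrakk> \<Longrightarrow> x \<oplus> (y \<oplus> z) = (x \<oplus> y) \<oplus> gyr x y z"
    and gyr_loop: "\<lbrakk>x \<in> G; y \<in> G; z \<in> G\<rbrakk> \<Longrightarrow> gyr (x \<oplus> y) y z = gyr x y z"

locale topological_gyrogroup = gyrogroup G add zero neg gyr
  for G :: "'a set" and add (infixl "\<oplus>" 65) and zero ("\<zero>")
    and neg ("\<ominus> _" [81] 80) and gyr +
  fixes T :: "'a topology"
  assumes topspace_eq: "topspace T = G"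
    and continuous_add: "continuous_map (prod_topology T T) T (\<lambda>(x, y). x \<oplus> y)"
    and continuous_neg: "continuous_map T T (\<lambda>x. \<ominus> x)"

text \<open>
  Neighbourhoods need not be open. The order on \<^typ>\<open>nat \<Rightarrow> nat\<close> is the pointwise one.
\<close>

definition nbhd_in :: "'a topology \<Rightarrow> 'a \<Rightarrow> 'a set \<Rightarrow> bool" where
  "nbhd_in X x N \<longleftrightarrow> N \<subseteq> topspace X \<and> (\<exists>V. openin X V \<and> x \<in> V \<and> V \<subseteq> N)"

definition has_omega_omega_base :: "'a topology \<Rightarrow> bool" where
  "has_omega_omega_base X \<longleftrightarrow>
     (\<forall>x \<in> topspace X. \<exists>U :: (nat \<Rightarrow> nat) \<Rightarrow> 'a set.
        (\<forall>\<alpha>. nbhd_in X x (U \<alpha>)) \<and>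
        (\<forall>N. nbhd_in X x N \<longrightarrow> (\<exists>\<alpha>. U \<alpha> \<subseteq> N)) \<and>
        (\<forall>\<alpha> \<beta>. \<alpha> \<le> \<beta> \<longrightarrow> U \<beta> \<subseteq> U \<alpha>))"

end

theory Submission
  imports Defs
begin

text \<open>
  The map \<open>(x, y) \<mapsto> \<ominus>x \<oplus> y\<close> is continuous and vanishes exactly on the diagonal, so by
  compactness an \<open>\<omega>\<^sup>\<omega>\<close>-base at \<open>\<zero>\<close> pulls back to an \<open>\<omega>\<^sup>\<omega>\<close>-base \<open>W\<close> of neighbourhoods of
  the diagonal of \<open>K \<times> K\<close>. Each continuous \<open>f : K \<rightarrow> [0,1]\<close> varies by less than \<open>1/8\<close> on some
  \<open>W \<alpha>\<close>. Among uncountably many \<open>f\<close>, infinitely many admit a common \<open>\<alpha>\<close>, because an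
  uncountable family in \<open>\<nat>\<^sup>\<nat>\<close> has an infinite bounded subfamily; by total boundedness two of
  these are uniformly closer than \<open>1/2\<close>. Hence a maximal \<open>1/2\<close>-separated set of such
  functions is countable. By Urysohn's lemma it separates points, which embeds \<open>K\<close> into
  \<open>\<real>\<^sup>\<nat>\<close>.
\<close>

text \<open>Splitting an uncountable set by the value of one coordinate gives countably many
  classes, so some class is again uncountable. Iterating over the coordinates yields a \<gamma> such
  that, for every n, infinitely many d have \<open>\<phi> d\<close> agreeing with \<gamma> below n.
  Distinct choices \<open>d n\<close>, one at each stage, form the bounded family.\<close>

lemma uncountable_imp_infinite_bounded_image:
  fixes \<phi> :: "'a \<Rightarrow> nat \<Rightarrow> nat"
  assumes "uncountable D"
  obtains E b where "E \<subseteq> D" "infinite E" "\<And>d. d \<in> E \<Longrightarrow> \<phi> d \<le> b"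
proof -
  define S where "S \<gamma> n = {d \<in> D. \<forall>i<n. \<phi> d i = \<gamma> i}" for \<gamma> :: "nat \<Rightarrow> nat" and n
  have step: "\<exists>k. uncountable {d \<in> C. \<phi> d n = k}" if "uncountable C" for C n
  proof (rule ccontr)
    assume "\<not> ?thesis"
    then have "countable (\<Union>k. {d \<in> C. \<phi> d n = k})" by auto
    moreover have "(\<Union>k. {d \<in> C. \<phi> d n = k}) = C" by auto
    ultimately show False using that by simp
  qed
  \<comment> \<open>The implication for \<open>n = 0\<close> carries the initial value
    \<open>C 0 = D\<close> through dependent choice.\<close>
  have "\<exists>C. \<forall>n. (uncountable (C n) \<and> (n = 0 \<longrightarrow> C n = D)) \<and>
      (\<exists>k. C (Suc n) = {d \<in> C n. \<phi> d n = k})"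
  proof (rule dependent_nat_choice)
    show "\<exists>x. uncountable x \<and> (0 = (0::nat) \<longrightarrow> x = D)" using assms by auto
  next
    fix x and n :: nat
    assume "uncountable x \<and> (n = 0 \<longrightarrow> x = D)"
    with step[of x n] show "\<exists>y. (uncountable y \<and> (Suc n = 0 \<longrightarrow> y = D)) \<and>
        (\<exists>k. y = {d \<in> x. \<phi> d n = k})"
      by blast
  qed
  then obtain C where C: "\<And>n. uncountable (C n)" "C 0 = D"
    "\<And>n. \<exists>k. C (Suc n) = {d \<in> C n. \<phi> d n = k}" by metis
  then obtain \<gamma> where \<gamma>: "\<And>n. C (Suc n) = {d \<in> C n. \<phi> d n = \<gamma> n}" by metis
  have CS: "C n = S \<gamma> n" for n
    by (induction n) (auto simp: S_def C(2) \<gamma> less_Suc_eq)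
  have inf: "infinite (S \<gamma> n)" for n
    using C(1)[of n] CS uncountable_infinite by metis
  have "\<exists>d. \<forall>n. d n \<in> S \<gamma> n - d ` {..<n}"
  proof -
    define pick where "pick n F = (SOME d. d \<in> S \<gamma> n - F)" for n F
    have pick: "pick n F \<in> S \<gamma> n - F" if "finite F" for n F
    proof -
      have "S \<gamma> n - F \<noteq> {}"
        using Diff_infinite_finite[OF that inf] by (metis finite.emptyI)
      then show ?thesis unfolding pick_def some_in_eq .
    qed
    \<comment> \<open>\<open>F n\<close> collects the points picked before stage n, so each new pick
      differs from all earlier ones.\<close>
    define F where "F = rec_nat {} (\<lambda>n F. insert (pick n F) F)"
    have F: "F 0 = {}" "F (Suc n) = insert (pick n (F n)) (F n)" for n
      by (auto simp: F_def)
    have fin: "finite (F n)" for n by (induction n) (auto simp: F)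
    have "F n = (\<lambda>n. pick n (F n)) ` {..<n}" for n
      by (induction n) (auto simp: F lessThan_Suc)
    with pick fin show ?thesis by (intro exI[of _ "\<lambda>n. pick n (F n)"]) metis
  qed
  then obtain d where d: "\<And>n. d n \<in> S \<gamma> n" "\<And>n. d n \<notin> d ` {..<n}" by auto
  have "inj d"
    using d(2) by (intro linorder_injI) (metis imageI lessThan_iff)
  \<comment> \<open>For n > i the value \<open>\<phi> (d n) i\<close> is already
    \<open>\<gamma> i\<close>, so the supremum at coordinate i is one over finitely many
    values.\<close>
  define b where "b i = Max (insert (\<gamma> i) ((\<lambda>n. \<phi> (d n) i) ` {..i}))" for i
  show ?thesis
  proof
    show "range d \<subseteq> D" using d(1) by (auto simp: S_def)
    show "infinite (range d)" using \<open>inj d\<close> by (simp add: finite_image_iff)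
  next
    fix e assume "e \<in> range d"
    then obtain n where e: "e = d n" by auto
    have "\<phi> (d n) i \<le> b i" for i
    proof (cases "n \<le> i")
      case True then show ?thesis unfolding b_def by (intro Max_ge) auto
    next
      case False
      then have "\<phi> (d n) i = \<gamma> i" using d(1)[of n] by (auto simp: S_def)
      then show ?thesis unfolding b_def by (intro Max_ge) auto
    qed
    then show "\<phi> e \<le> b" by (simp add: e le_fun_def)
  qed
qed

text \<open>Zorn's lemma applies because pairwise relatedness passes to unions of chains. An f
  outside D related to every member of D could be inserted, contradicting maximality; symmetry of R
  supplies the reverse direction.\<close>

lemma exists_maximal_pairwise_subset:
  assumes "symp R"
  obtains D where "D \<subseteq> A" "pairwise R D" "\<And>f. f \<in> A \<Longrightarrow> f \<in> D \<or> (\<exists>g\<in>D. \<not> R f g)"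
proof -
  have "\<exists>M\<in>{D. D \<subseteq> A \<and> pairwise R D}. \<forall>X\<in>{D. D \<subseteq> A \<and> pairwise R D}. M \<subseteq> X \<longrightarrow> X = M"
  proof (rule subset_Zorn_nonempty)
    show "{D. D \<subseteq> A \<and> pairwise R D} \<noteq> {}" using pairwise_empty by blast
  next
    fix \<C> assume "\<C> \<noteq> {}" and \<C>: "subset.chain {D. D \<subseteq> A \<and> pairwise R D} \<C>"
    then show "\<Union>\<C> \<in> {D. D \<subseteq> A \<and> pairwise R D}"
      using pairwise_chain_Union[of \<C> R] by (auto simp: subset_chain_def chain_subset_def)
  qed
  then obtain D where D: "D \<subseteq> A" "pairwise R D"
    and max: "\<And>X. X \<subseteq> A \<Longrightarrow> pairwise R X \<Longrightarrow> D \<subseteq> X \<Longrightarrow> X = D" by auto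
  show ?thesis
  proof
    fix f assume "f \<in> A"
    show "f \<in> D \<or> (\<exists>g\<in>D. \<not> R f g)"
    proof (rule ccontr)
      assume *: "\<not> ?thesis"
      then have "pairwise R (insert f D)"
        using D(2) assms by (auto simp: pairwise_insert dest: sympD)
      with max[of "insert f D"] * D(1) \<open>f \<in> A\<close> show False by auto
    qed
  qed (fact D)+
qed

text \<open>Evaluation at an enumeration of the functions is a continuous injection into the
  metrizable space of real sequences. A continuous injection from a compact space into a Hausdorff
  one is an embedding.\<close>

lemma metrizable_space_countable_separating:
  fixes D :: "('a \<Rightarrow> real) set"
  assumes "compact_space X" and "countable D"
    and cont: "\<And>f. f \<in> D \<Longrightarrow> continuous_map X euclideanreal f"
    and sep: "\<And>x y. \<lbrakk>x \<in> topspace X; y \<in> topspace X; x \<noteq> y\<rbrakk> \<Longrightarrow> \<exists>f\<in>D. f x \<noteq> f y"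
  shows "metrizable_space X"
proof -
  \<comment> \<open>D may be empty when X has at most one point; the added zero function ensures
    that \<open>from_nat_into\<close> enumerates a nonempty set.\<close>
  define D' where "D' = insert (\<lambda>_. 0) D"
  have D': "countable D'" "D' \<noteq> {}" using assms by (auto simp: D'_def)
  have cont': "continuous_map X euclideanreal f" if "f \<in> D'" for f
    using that cont by (auto simp: D'_def)
  define F where "F x n = from_nat_into D' n x" for x n
  have "continuous_map X (product_topology (\<lambda>_::nat. euclideanreal) UNIV) F"
    unfolding continuous_map_componentwise_UNIV F_def
    using cont' from_nat_into[OF D'(2)] by blast
  then have "continuous_map X euclidean F" by (simp add: euclidean_product_topology)
  moreover have "inj_on F (topspace X)"
  proof (rule inj_onI, rule ccontr)
    fix x y assume xy: "x \<in> topspace X" "y \<in> topspace X" "F x = F y" "x \<noteq> y"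
    then obtain f where "f \<in> D'" "f x \<noteq> f y" using sep by (auto simp: D'_def)
    moreover obtain n where "from_nat_into D' n = f"
      using from_nat_into_surj[OF D'(1) \<open>f \<in> D'\<close>] by auto
    ultimately show False using fun_cong[OF xy(3), of n] by (simp add: F_def)
  qed
  ultimately have "embedding_map X euclidean F"
    using \<open>compact_space X\<close> by (intro continuous_imp_embedding_map) auto
  then have "X homeomorphic_space subtopology euclidean (F ` topspace X)"
    by (rule embedding_map_imp_homeomorphic_space)
  then show ?thesis
    using homeomorphic_metrizable_space metrizable_space_subtopology metrizable_space_euclidean
    by blast
qed

text \<open>Total boundedness: the sections of V are open and contain their base points, so finitely
  many of them cover X.\<close>

lemma finite_uniform_net:
  assumes "compact_space X" and V: "openin (prod_topology X X) V"
    and diag: "\<And>x. x \<in> topspace X \<Longrightarrow> (x, x) \<in> V"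
  obtains P where "finite P" "P \<subseteq> topspace X" "\<And>y. y \<in> topspace X \<Longrightarrow> \<exists>x\<in>P. (x, y) \<in> V"
proof -
  define B where "B x = {y \<in> topspace X. (x, y) \<in> V}" for x
  have op: "openin X (B x)" if "x \<in> topspace X" for x
    unfolding B_def using that
    by (intro openin_continuous_map_preimage[OF _ V]) (auto simp: continuous_map_pairedI)
  have "\<exists>\<F>. finite \<F> \<and> \<F> \<subseteq> B ` topspace X \<and> topspace X \<subseteq> \<Union>\<F>"
    using \<open>compact_space X\<close> op diag unfolding compact_space_alt
    by (elim allE[of _ "B ` topspace X"]) (force simp: B_def)
  then obtain P where "finite P" "P \<subseteq> topspace X" "topspace X \<subseteq> \<Union>(B ` P)"
    by (metis finite_subset_image)
  then show ?thesis using that by (force simp: B_def)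
qed

text \<open>The part free of gyrogroups: here W is a base, ordered like
  \<open>\<nat>\<^sup>\<nat>\<close>, of the filter of neighbourhoods of the diagonal.\<close>

lemma compact_diagonal_omega_base_imp_metrizable:
  fixes W :: "(nat \<Rightarrow> nat) \<Rightarrow> ('a \<times> 'a) set"
  assumes X: "compact_space X" "Hausdorff_space X"
    and nbhd: "\<And>\<alpha>. \<exists>V. openin (prod_topology X X) V \<and> (\<forall>x\<in>topspace X. (x, x) \<in> V) \<and> V \<subseteq> W \<alpha>"
    and base: "\<And>V. \<lbrakk>openin (prod_topology X X) V; \<And>x. x \<in> topspace X \<Longrightarrow> (x, x) \<in> V\<rbrakk>
      \<Longrightarrow> \<exists>\<alpha>. W \<alpha> \<subseteq> V"
    and mono: "\<And>\<alpha> \<beta>. \<alpha> \<le> \<beta> \<Longrightarrow> W \<beta> \<subseteq> W \<alpha>"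
  shows "metrizable_space X"
proof -
  define A where "A = {f. continuous_map X (top_of_set {0..1::real}) f}"
  \<comment> \<open>The threshold 1/2 is small enough that a g closer than this to an f with values
    0 and 1 at two points still separates them, and large enough to exceed the error 3/8 obtained
    below.\<close>
  define R where "R f g \<longleftrightarrow> (\<exists>x\<in>topspace X. \<bar>f x - g x\<bar> \<ge> (1/2::real))" for f g
  have "symp R" by (auto simp: symp_def R_def abs_minus_commute)
  then obtain D where D: "D \<subseteq> A" "pairwise R D"
    and max: "\<And>f. f \<in> A \<Longrightarrow> f \<in> D \<or> (\<exists>g\<in>D. \<not> R f g)"
    using exists_maximal_pairwise_subset by blast
  have contA: "continuous_map X euclideanreal f" if "f \<in> A" for f
    using that by (auto simp: A_def continuous_map_in_subtopology)
  have rangeA: "f x \<in> {0..1}" if "f \<in> A" "x \<in> topspace X" for f x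
    using that by (auto simp: A_def continuous_map_in_subtopology)
  have modulus: "\<exists>\<alpha>. \<forall>(x,y)\<in>W \<alpha>. \<bar>f x - f y\<bar> < 1/8" if "f \<in> A" for f
  proof -
    define V where "V = {p \<in> topspace (prod_topology X X). f (fst p) - f (snd p) \<in> {-1/8<..<1/8}}"
    have "openin (prod_topology X X) V"
      unfolding V_def
    proof (rule openin_continuous_map_preimage)
      show "continuous_map (prod_topology X X) euclideanreal (\<lambda>p. f (fst p) - f (snd p))"
        using continuous_map_compose[OF continuous_map_fst contA[OF that]]
          continuous_map_compose[OF continuous_map_snd contA[OF that]]
        by (intro continuous_map_diff) (simp_all add: o_def)
    qed auto
    moreover have "(x, x) \<in> V" if "x \<in> topspace X" for x
      using that by (simp add: V_def)
    ultimately obtain \<alpha> where "W \<alpha> \<subseteq> V" using base by blast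
    then show ?thesis by (intro exI[of _ \<alpha>]) (auto simp: V_def abs_if dest!: subsetD)
  qed
  then obtain \<phi> where \<phi>: "\<And>f x y. f \<in> A \<Longrightarrow> (x, y) \<in> W (\<phi> f) \<Longrightarrow> \<bar>f x - f y\<bar> < 1/8"
    by (metis (no_types, lifting) case_prodD)
  have "countable D"
  proof (rule ccontr)
    assume "uncountable D"
    then obtain E \<beta> where E: "E \<subseteq> D" "infinite E" "\<And>f. f \<in> E \<Longrightarrow> \<phi> f \<le> \<beta>"
      using uncountable_imp_infinite_bounded_image by blast
    have equi: "\<bar>f x - f y\<bar> < 1/8" if "f \<in> E" "(x, y) \<in> W \<beta>" for f x y
    proof (rule \<phi>)
      show "f \<in> A" using that(1) E(1) D(1) by blast
      show "(x, y) \<in> W (\<phi> f)" using that(2) mono[OF E(3)[OF that(1)]] by blast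
    qed
    obtain V where V: "openin (prod_topology X X) V" "\<And>x. x \<in> topspace X \<Longrightarrow> (x, x) \<in> V"
      "V \<subseteq> W \<beta>" using nbhd[of \<beta>] by blast
    obtain P where P: "finite P" "P \<subseteq> topspace X" "\<And>y. y \<in> topspace X \<Longrightarrow> \<exists>x\<in>P. (x, y) \<in> V"
      using finite_uniform_net[OF X(1) V(1,2)] by blast
    \<comment> \<open>The cell records the values on the net rounded down to multiples of 1/8.
      Restricting to P leaves finitely many possible cells, so two functions in the infinite set E
      share one. The index 8 occurs when a value is 1.\<close>
    define cell where "cell f = restrict (\<lambda>x. \<lfloor>8 * f x\<rfloor>) P" for f :: "'a \<Rightarrow> real"
    have "cell f \<in> P \<rightarrow>\<^sub>E {0..8}" if "f \<in> E" for f
    proof -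
      have "\<lfloor>8 * f x\<rfloor> \<in> {0..8}" if "x \<in> P" for x
      proof -
        have "f x \<in> {0..1}" using rangeA \<open>f \<in> E\<close> that E(1) D(1) P(2) by blast
        then show ?thesis by (simp add: floor_le_iff)
      qed
      then show ?thesis by (auto simp: cell_def)
    qed
    then have "cell ` E \<subseteq> P \<rightarrow>\<^sub>E {0..8}" by blast
    moreover have "finite (P \<rightarrow>\<^sub>E {0..8::int})" using P(1) by (simp add: finite_PiE)
    ultimately have "finite (cell ` E)" by (rule finite_subset)
    with E(2) have "\<not> inj_on cell E" using finite_imageD by blast
    then obtain f g where fg: "f \<in> E" "g \<in> E" "f \<noteq> g" "cell f = cell g"
      unfolding inj_on_def by blast
    \<comment> \<open>Pass through a net point x near y: the steps from f y to f x, to g x, to g y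
      each cost less than 1/8.\<close>
    have "\<bar>f y - g y\<bar> < 1/2" if y: "y \<in> topspace X" for y
    proof -
      obtain x where x: "x \<in> P" "(x, y) \<in> V" using P(3) y by blast
      then have "\<lfloor>8 * f x\<rfloor> = \<lfloor>8 * g x\<rfloor>" using fun_cong[OF fg(4), of x] by (simp add: cell_def)
      then have "\<bar>f x - g x\<bar> < 1/8" by linarith
      moreover have "\<bar>f x - f y\<bar> < 1/8" "\<bar>g x - g y\<bar> < 1/8"
        using equi fg(1,2) x(2) V(3) by blast+
      ultimately show ?thesis by linarith
    qed
    then have "\<not> R f g" by (force simp: R_def)
    moreover have "R f g" using D(2) fg E(1) by (auto simp: pairwise_def)
    ultimately show False by simp
  qed
  then show ?thesis
  proof (rule metrizable_space_countable_separating[OF X(1)])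
    show "continuous_map X euclideanreal f" if "f \<in> D" for f
      using that D(1) contA by blast
  next
    fix x y assume xy: "x \<in> topspace X" "y \<in> topspace X" "x \<noteq> y"
    have "normal_space X" using X compact_Hausdorff_or_regular_imp_normal_space by blast
    moreover have "closedin X {x}" "closedin X {y}"
      using X(2) xy by (auto simp: closedin_Hausdorff_singleton)
    ultimately obtain f where f: "continuous_map X (top_of_set {0..1::real}) f"
        "f ` {x} \<subseteq> {0}" "f ` {y} \<subseteq> {1}"
      using xy(3) by (metis Urysohn_lemma disjnt_insert1 disjnt_empty1 empty_iff insert_iff zero_le_one)
    \<comment> \<open>If the Urysohn function f is not itself in D, maximality gives a g in D
      uniformly near it, and then g x < 1/2 < g y.\<close>
    then consider "f \<in> D" | g where "g \<in> D" "\<not> R f g" using max by (auto simp: A_def)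
    then show "\<exists>f\<in>D. f x \<noteq> f y"
    proof cases
      case 1
      moreover have "f x \<noteq> f y" using f(2,3) by simp
      ultimately show ?thesis by blast
    next
      case 2
      then have "\<bar>f x - g x\<bar> < 1/2" "\<bar>f y - g y\<bar> < 1/2"
        using xy by (auto simp: R_def not_le)
      then have "g x \<noteq> g y" using f by auto
      then show ?thesis using 2 by blast
    qed
  qed
qed

context gyrogroup
begin

text \<open>Gyroassociativity with \<ominus>x \<oplus> x = \<zero>. Injectivity of the gyration on
  the right then gives left cancellation.\<close>

lemma neg_add_gyr: "\<lbrakk>x \<in> G; z \<in> G\<rbrakk> \<Longrightarrow> \<ominus> x \<oplus> (x \<oplus> z) = gyr (\<ominus> x) x z"
  by (metis gyr_assoc gyr_bij bij_betwE neg_add neg_closed zero_add)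

lemma add_left_cancel: "\<lbrakk>x \<in> G; z \<in> G; w \<in> G; x \<oplus> z = x \<oplus> w\<rbrakk> \<Longrightarrow> z = w"
  by (metis bij_betw_imp_inj_on gyr_bij inj_onD neg_add_gyr neg_closed)

text \<open>Cancel \<ominus>x in \<ominus>x \<oplus> y = \<ominus>x \<oplus> x. This places the
  zeros of the map \<open>h\<close> below exactly on the diagonal.\<close>

lemma neg_add_eq_zero_iff: "\<lbrakk>x \<in> G; y \<in> G\<rbrakk> \<Longrightarrow> \<ominus> x \<oplus> y = \<zero> \<longleftrightarrow> x = y"
  by (metis add_left_cancel neg_add neg_closed)

end

theorem theorem3p2:
  fixes G :: "'a set" and add :: "'a \<Rightarrow> 'a \<Rightarrow> 'a" and zero :: 'a
    and neg :: "'a \<Rightarrow> 'a" and gyr :: "'a \<Rightarrow> 'a \<Rightarrow> 'a \<Rightarrow> 'a"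
    and T :: "'a topology" and K :: "'a set"
  assumes "topological_gyrogroup G add zero neg gyr T"
    and "Hausdorff_space T"
    and "has_omega_omega_base T"
    and "compactin T K"
  shows "metrizable_space (subtopology T K)"
proof -
  interpret topological_gyrogroup G add zero neg gyr T by fact
  let ?X = "subtopology T K"
  let ?P = "prod_topology ?X ?X"
  have KG: "K \<subseteq> G" using assms(4) compactin_subset_topspace topspace_eq by blast
  have tX: "topspace ?X = K" using KG topspace_eq by auto
  have comp: "compact_space ?X" using assms(4) by (rule compact_space_subtopology)
  have haus: "Hausdorff_space ?X" using assms(2) by (rule Hausdorff_space_subtopology)
  define h where "h p = add (neg (fst p)) (snd p)" for p
  have h: "continuous_map ?P T h"
  proof -
    have "continuous_map ?P T (\<lambda>p. neg (fst p))" "continuous_map ?P T snd"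
      using continuous_map_compose[OF _ continuous_neg, of ?P fst] 
      by (auto simp: o_def intro: continuous_map_into_fulltopology
          continuous_map_fst continuous_map_snd)
    then have "continuous_map ?P (prod_topology T T) (\<lambda>p. (neg (fst p), snd p))"
      by (simp add: continuous_map_pairedI)
    from continuous_map_compose[OF this continuous_add] show ?thesis
      by (simp add: o_def h_def[abs_def])
  qed
  obtain U :: "(nat \<Rightarrow> nat) \<Rightarrow> 'a set" where U: "\<And>\<alpha>. nbhd_in T zero (U \<alpha>)"
    "\<And>N. nbhd_in T zero N \<Longrightarrow> \<exists>\<alpha>. U \<alpha> \<subseteq> N" "\<And>\<alpha> \<beta>. \<alpha> \<le> \<beta> \<Longrightarrow> U \<beta> \<subseteq> U \<alpha>"
    using assms(3) zero_closed topspace_eq unfolding has_omega_omega_base_def by metis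
  define W where "W \<alpha> = {p \<in> topspace ?P. h p \<in> U \<alpha>}" for \<alpha>
  show ?thesis
  proof (rule compact_diagonal_omega_base_imp_metrizable[OF comp haus, of W])
    fix \<alpha>
    obtain O' where O': "openin T O'" "zero \<in> O'" "O' \<subseteq> U \<alpha>"
      using U(1) unfolding nbhd_in_def by blast
    show "\<exists>V. openin ?P V \<and> (\<forall>x\<in>topspace ?X. (x, x) \<in> V) \<and> V \<subseteq> W \<alpha>"
    proof (intro exI conjI)
      show "openin ?P {p \<in> topspace ?P. h p \<in> O'}"
        using h O'(1) by (rule openin_continuous_map_preimage)
    qed (use O' KG neg_add in \<open>auto simp: W_def h_def\<close>)
  next
    fix V assume V: "openin ?P V" "\<And>x. x \<in> topspace ?X \<Longrightarrow> (x, x) \<in> V"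
    \<comment> \<open>The complement of V is compact and misses the diagonal, so its image Q is
      compact, hence closed in the Hausdorff space T, and omits \<open>zero\<close>. Any
      \<open>U \<alpha>\<close> that avoids Q pulls back into V.\<close>
    define Q where "Q = h ` (topspace ?P - V)"
    have "compactin ?P (topspace ?P - V)"
      using comp V(1)
      by (intro closedin_compact_space closedin_diff closedin_topspace)
        (simp_all only: compact_space_prod_topology simp_thms)
    then have "compactin T Q" unfolding Q_def using h by (rule image_compactin)
    then have "closedin T Q" using assms(2) by (rule compactin_imp_closedin[rotated])
    moreover have "zero \<notin> Q"
      using V(2) tX KG neg_add_eq_zero_iff by (fastforce simp: Q_def h_def)
    ultimately have "nbhd_in T zero (topspace T - Q)"
      using zero_closed topspace_eq unfolding nbhd_in_def by blast
    then obtain \<alpha> where "U \<alpha> \<subseteq> topspace T - Q" using U(2) by blast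
    then have "W \<alpha> \<subseteq> V" by (auto simp: W_def Q_def)
    then show "\<exists>\<alpha>. W \<alpha> \<subseteq> V" by blast
  next
    fix \<alpha> \<beta> :: "nat \<Rightarrow> nat" assume "\<alpha> \<le> \<beta>"
    then show "W \<beta> \<subseteq> W \<alpha>" using U(3) by (auto simp: W_def)
  qed
qed

end
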